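(* Let $n\ge 0$, $0\le k\le n$, and let $U,V\subseteq\{1,\ldots,n\}$ with $|U|=|V|$. Then $b(n,k,U)=b(n,k,V)$.
   Context: $\mathcal{B}_n$ is the set of signed permutations of order $n$: bijections $\sigma$ of $\{-n,\ldots,-1,0,1,\ldots,n\}$ with $\sigma(-i)=-\sigma(i)$ for all $i$ (so $\sigma(0)=0$), identified with the sequence $(0,\sigma_1,\ldots,\sigma_n)$ where $\sigma_i=\sigma(i)$. The number of descents $\mathrm{des}(\sigma)$ is the number of $i\in\{1,\ldots,n\}$ with $\sigma_{i-1}>\sigma_i$, where $\sigma_0=0$. For $U\subseteq\{1,\ldots,n\}$ and $0\le k\le n$, $\mathcal{B}_{n,k,U}$ is the set of $\sigma\in\mathcal{B}_n$ with $\mathrm{des}(\sigma)=k$ such that for every $1\le i\le n$: $\sigma_i<0$ if and only if $|\sigma_i|\in U$; and $b(n,k,U):=|\mathcal{B}_{n,k,U}|$. *)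

theory Defs
  imports "HOL-Combinatorics.Permutations"
begin

text \<open>Being a bijection of \<open>{-n..n}\<close> is rendered by \<^const>\<open>permutes\<close>, i.e. a signed permutation
  is extended by the identity outside that interval; so each one is represented by exactly one
  function. The value \<open>\<sigma> 0 = 0\<close> follows from the case \<open>i = 0\<close> of the oddness condition.\<close>

definition signed_perms :: "nat \<Rightarrow> (int \<Rightarrow> int) set" where
  "signed_perms n =
     {\<sigma>. \<sigma> permutes {- int n..int n} \<and> (\<forall>i\<in>{- int n..int n}. \<sigma> (- i) = - \<sigma> i)}"

definition des :: "nat \<Rightarrow> (int \<Rightarrow> int) \<Rightarrow> nat" where
  "des n \<sigma> = card {i \<in> {1..int n}. \<sigma> (i - 1) > \<sigma> i}"

definition signed_perms_des_neg :: "nat \<Rightarrow> nat \<Rightarrow> int set \<Rightarrow> (int \<Rightarrow> int) set" where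
  "signed_perms_des_neg n k U =
     {\<sigma> \<in> signed_perms n. des n \<sigma> = k \<and> (\<forall>i\<in>{1..int n}. \<sigma> i < 0 \<longleftrightarrow> \<bar>\<sigma> i\<bar> \<in> U)}"

definition b :: "nat \<Rightarrow> nat \<Rightarrow> int set \<Rightarrow> nat" where
  "b n k U = card (signed_perms_des_neg n k U)"

end

theory Submission
  imports Defs
begin

text \<open>Descents depend only on the relative order of the entries. The entries of a signed
  permutation counted by \<open>b n k U\<close>, together with \<open>\<sigma> 0 = 0\<close>, form the set
  \<open>{0} \<union> -U \<union> ({1..n} - U)\<close>, in which exactly \<open>card U\<close> elements lie below \<open>0\<close>. Hence the
  increasing bijection onto the analogous set for \<open>V\<close> fixes \<open>0\<close> and preserves signs, and
  composing with its odd extension to \<open>{-n..n}\<close> preserves descents and turns the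
  condition for \<open>U\<close> into the one for \<open>V\<close>.\<close>

text \<open>Induction on the largest element: it is sent to \<open>Max B\<close>, and the remaining
  elements are matched with those of \<open>B\<close> below that maximum.\<close>

lemma ex_strict_mono_on_image:
  fixes A :: "'a::linorder set" and B :: "'b::linorder set"
  assumes "finite A" "finite B" "card A = card B"
  shows "\<exists>f. strict_mono_on A f \<and> f ` A = B"
  using assms
proof (induction A arbitrary: B rule: finite_linorder_max_induct)
  case empty
  then show ?case by simp
next
  case (insert a A)
  then have "a \<notin> A" by auto
  with insert have card: "card B = Suc (card A)" by simp
  then have "B \<noteq> {}" by auto
  define m where "m = Max B"
  have "m \<in> B" and m_ge: "\<And>y. y \<in> B \<Longrightarrow> y \<le> m"
    using \<open>B \<noteq> {}\<close> insert.prems by (auto simp: m_def)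
  with insert.IH[of "B - {m}"] insert.prems card
  obtain f where f: "strict_mono_on A f" "f ` A = B - {m}"
    by auto
  have less_m: "f x < m" if "x \<in> A" for x
  proof -
    have "f x \<in> B - {m}" using f(2) that by blast
    with m_ge show ?thesis by (auto simp: order.order_iff_strict)
  qed
  have "strict_mono_on (insert a A) (f(a := m))"
    using f(1) less_m insert.hyps(2) \<open>a \<notin> A\<close>
    by (intro strict_mono_onI) (auto dest: strict_mono_onD order.asym)
  moreover have "f(a := m) ` insert a A = B"
    using f(2) \<open>a \<notin> A\<close> \<open>m \<in> B\<close> by (auto simp: image_iff)
  ultimately show ?case by blast
qed

text \<open>Two increasing bijections, \<open>U\<close> onto \<open>V\<close> and
  \<open>A - U\<close> onto \<open>A - V\<close>, are glued together. Monotonicity is claimed only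
  on each piece: \<open>U\<close> will serve the absolute values of negative entries,
  \<open>A - U\<close> the positive entries.\<close>

lemma ex_permutes_strict_mono_on:
  fixes A :: "'a::linorder set"
  assumes "finite A" "U \<subseteq> A" "V \<subseteq> A" "card U = card V"
  obtains p where "p permutes A" "p ` U = V"
    "strict_mono_on U p" "strict_mono_on (A - U) p"
proof -
  have fin: "finite U" "finite V"
    using assms finite_subset by auto
  obtain f where f: "strict_mono_on U f" "f ` U = V"
    using ex_strict_mono_on_image[of U V] fin assms(4) by blast
  have "card (A - U) = card (A - V)"
    using assms fin by (simp add: card_Diff_subset)
  then obtain g where g: "strict_mono_on (A - U) g" "g ` (A - U) = A - V"
    using ex_strict_mono_on_image[of "A - U" "A - V"] assms(1) by blast
  define p where "p x = (if x \<in> U then f x else if x \<in> A then g x else x)" for x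
  have U: "strict_mono_on U p" "p ` U = V"
    using f by (auto simp: p_def strict_mono_on_def image_iff)
  have D: "strict_mono_on (A - U) p" "p ` (A - U) = A - V"
    using g by (auto simp: p_def strict_mono_on_def image_iff)
  have "bij_betw p U V" "bij_betw p (A - U) (A - V)"
    using U D by (simp_all add: bij_betw_def strict_mono_on_imp_inj_on)
  then have "bij_betw p (U \<union> (A - U)) (V \<union> (A - V))"
    by (rule bij_betw_combine) blast
  then have "bij_betw p A A"
    using assms(2,3) by (simp add: Un_absorb1)
  then have "p permutes A"
    using assms(2) by (intro bij_imp_permutes) (auto simp: p_def)
  with U D that show ?thesis by blast
qed

text \<open>The factor \<open>sgn x\<close> makes the extension odd on all integers and forces the
  value \<open>0\<close> at \<open>0\<close>.\<close>

definition odd_ext :: "(int \<Rightarrow> int) \<Rightarrow> int \<Rightarrow> int" where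
  "odd_ext p x = sgn x * p \<bar>x\<bar>"

lemma odd_ext_minus: "odd_ext p (- x) = - odd_ext p x"
  by (simp add: odd_ext_def)

context
  fixes p :: "int \<Rightarrow> int" and n :: nat
  assumes p: "p permutes {1..int n}"
begin

text \<open>Beyond \<open>n\<close> the permutation fixes \<open>x\<close>, so the rules for sign
  and absolute value below hold on all integers.\<close>

lemma permutes_pos: "0 < x \<Longrightarrow> 0 < p x"
  using permutes_in_image[OF p, of x] permutes_not_in[OF p, of x]
  by (cases "x \<in> {1..int n}") auto

lemma abs_odd_ext: "\<bar>odd_ext p x\<bar> = (if x = 0 then 0 else p \<bar>x\<bar>)"
  using permutes_pos[of "\<bar>x\<bar>"] by (auto simp: odd_ext_def abs_mult)

lemma sgn_odd_ext: "sgn (odd_ext p x) = sgn x"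
  using permutes_pos[of "\<bar>x\<bar>"] by (cases "x = 0") (auto simp: odd_ext_def sgn_mult)

lemma odd_ext_permutes: "odd_ext p permutes {- int n..int n}"
proof (rule bij_imp_permutes)
  \<comment> \<open>An integer is recovered from its sign, which \<open>odd_ext p\<close> keeps, and
    its absolute value, on which the injective \<open>p\<close> acts.\<close>
  have "inj (odd_ext p)"
  proof
    fix x y assume eq: "odd_ext p x = odd_ext p y"
    then have s: "sgn x = sgn y"
      by (metis sgn_odd_ext)
    show "x = y"
    proof (cases "x = 0")
      case False
      with s have "y \<noteq> 0" by (auto simp: sgn_0_0)
      with False eq have "p \<bar>x\<bar> = p \<bar>y\<bar>"
        by (metis abs_odd_ext)
      then have "\<bar>x\<bar> = \<bar>y\<bar>"
        using permutes_inj[OF p] by (auto dest: injD)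
      with s show ?thesis by (metis mult_sgn_abs)
    qed (use s in \<open>simp add: sgn_0_0\<close>)
  qed
  moreover have "odd_ext p x \<in> {- int n..int n}" if "x \<in> {- int n..int n}" for x
  proof (cases "x = 0")
    case False
    with that have "p \<bar>x\<bar> \<in> {1..int n}"
      by (subst permutes_in_image[OF p]) auto
    with abs_odd_ext[of x] False show ?thesis by auto
  qed (simp add: odd_ext_def)
  ultimately show "bij_betw (odd_ext p) {- int n..int n} {- int n..int n}"
    unfolding bij_betw_def
    by (metis endo_inj_surj finite_atLeastAtMost_int image_subsetI inj_on_subset subset_UNIV)
next
  fix x assume "x \<notin> {- int n..int n}"
  then have "p \<bar>x\<bar> = \<bar>x\<bar>"
    by (intro permutes_not_in[OF p]) auto
  then show "odd_ext p x = x"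
    by (simp add: odd_ext_def sgn_mult_abs)
qed

text \<open>The set consists of \<open>0\<close>, negatives of elements of \<open>U\<close>, and
  positive numbers outside \<open>U\<close>. On the negative part the order is reversed twice, so
  \<open>p\<close> increasing on \<open>U\<close> suffices; across \<open>0\<close> the signs
  decide.\<close>

lemma odd_ext_strict_mono_on:
  assumes U: "strict_mono_on U p" and D: "strict_mono_on ({1..int n} - U) p"
  shows "strict_mono_on {x \<in> {- int n..int n}. x \<noteq> 0 \<longrightarrow> (x < 0 \<longleftrightarrow> \<bar>x\<bar> \<in> U)} (odd_ext p)"
    (is "strict_mono_on ?S _")
proof (rule strict_mono_onI)
  fix x y assume xy: "x \<in> ?S" "y \<in> ?S" "x < y"
  consider "x < 0" "y < 0" | "0 < x" "0 < y" | "x \<le> 0" "0 \<le> y"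
    using \<open>x < y\<close> by linarith
  then show "odd_ext p x < odd_ext p y"
  proof cases
    case 1
    with xy strict_mono_onD[OF U, of "- y" "- x"] show ?thesis
      by (simp add: odd_ext_def)
  next
    case 2
    with xy strict_mono_onD[OF D, of x y] show ?thesis
      by (simp add: odd_ext_def)
  next
    case 3
    with xy permutes_pos[of y] permutes_pos[of "- x"] show ?thesis
      by (auto simp: odd_ext_def sgn_if)
  qed
qed

end

lemma finite_signed_perms_des_neg: "finite (signed_perms_des_neg n k U)"
  by (rule finite_subset[OF _ finite_permutations[of "{- int n..int n}"]])
    (auto simp: signed_perms_des_neg_def signed_perms_def)

lemma odd_ext_comp_signed_perms_des_neg:
  assumes p: "p permutes {1..int n}" and UV: "p ` U = V"
    and mono: "strict_mono_on U p" "strict_mono_on ({1..int n} - U) p"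
    and \<sigma>: "\<sigma> \<in> signed_perms_des_neg n k U"
  shows "odd_ext p \<circ> \<sigma> \<in> signed_perms_des_neg n k V"
proof -
  let ?I = "{- int n..int n}"
  let ?S = "{x \<in> ?I. x \<noteq> 0 \<longrightarrow> (x < 0 \<longleftrightarrow> \<bar>x\<bar> \<in> U)}"
  have perm: "\<sigma> permutes ?I" and odd: "\<And>i. i \<in> ?I \<Longrightarrow> \<sigma> (- i) = - \<sigma> i"
    and des: "des n \<sigma> = k"
    and neg: "\<And>i. i \<in> {1..int n} \<Longrightarrow> \<sigma> i < 0 \<longleftrightarrow> \<bar>\<sigma> i\<bar> \<in> U"
    using \<sigma> by (auto simp: signed_perms_des_neg_def signed_perms_def)
  have "\<sigma> 0 = 0"
    using odd[of 0] by simp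
  \<comment> \<open>Index \<open>0\<close> is included because a descent at \<open>i = 1\<close>
    compares with \<open>\<sigma> 0\<close>.\<close>
  have S: "\<sigma> i \<in> ?S" if "i \<in> {0..int n}" for i
  proof (cases "i = 0")
    case False
    then show ?thesis
      using that permutes_in_image[OF perm, of i] neg[of i] by auto
  qed (use \<open>\<sigma> 0 = 0\<close> in simp)
  have "odd_ext p (\<sigma> i) < odd_ext p (\<sigma> (i - 1)) \<longleftrightarrow> \<sigma> i < \<sigma> (i - 1)"
    if "i \<in> {1..int n}" for i
    by (rule strict_mono_on_less[OF odd_ext_strict_mono_on[OF p mono]]) (rule S, use that in simp)+
  then have "{i \<in> {1..int n}. odd_ext p (\<sigma> i) < odd_ext p (\<sigma> (i - 1))}
      = {i \<in> {1..int n}. \<sigma> i < \<sigma> (i - 1)}"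
    by blast
  then have "des n (odd_ext p \<circ> \<sigma>) = k"
    using des by (simp add: des_def)
  moreover have "odd_ext p (\<sigma> i) < 0 \<longleftrightarrow> \<bar>odd_ext p (\<sigma> i)\<bar> \<in> V" if "i \<in> {1..int n}" for i
  proof -
    have "\<sigma> i \<noteq> 0"
      using permutes_inj[OF perm] \<open>\<sigma> 0 = 0\<close> that by (metis atLeastAtMost_iff injD not_one_le_zero)
    then have "\<bar>odd_ext p (\<sigma> i)\<bar> \<in> V \<longleftrightarrow> \<bar>\<sigma> i\<bar> \<in> U"
      using UV inj_image_mem_iff[OF permutes_inj[OF p]] by (auto simp: abs_odd_ext[OF p])
    moreover have "odd_ext p (\<sigma> i) < 0 \<longleftrightarrow> \<sigma> i < 0"
      by (metis sgn_odd_ext[OF p] sgn_less)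
    ultimately show ?thesis
      using neg[OF that] by simp
  qed
  ultimately show ?thesis
    using permutes_compose[OF perm odd_ext_permutes[OF p]] odd
    by (simp add: signed_perms_des_neg_def signed_perms_def odd_ext_minus)
qed

text \<open>Composition on the left with the bijection \<open>odd_ext p\<close> is injective and
  maps the signed permutations for \<open>U\<close> into those for \<open>V\<close>. The hypotheses
  are symmetric in \<open>U\<close> and \<open>V\<close>, so the reverse inequality follows by
  exchanging them.\<close>

lemma b_le:
  assumes "U \<subseteq> {1..int n}" "V \<subseteq> {1..int n}" "card U = card V"
  shows "b n k U \<le> b n k V"
proof -
  obtain p where p: "p permutes {1..int n}" "p ` U = V"
    "strict_mono_on U p" "strict_mono_on ({1..int n} - U) p"
    using ex_permutes_strict_mono_on[OF finite_atLeastAtMost_int assms] .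
  have "inj (odd_ext p)"
    using permutes_inj[OF odd_ext_permutes[OF p(1)]] .
  then have "inj_on ((\<circ>) (odd_ext p)) (signed_perms_des_neg n k U)"
    by (auto intro!: inj_onI simp: fun.inj_map[THEN inj_eq])
  moreover have "(\<circ>) (odd_ext p) ` signed_perms_des_neg n k U \<subseteq> signed_perms_des_neg n k V"
    using odd_ext_comp_signed_perms_des_neg[OF p] by blast
  ultimately show ?thesis
    unfolding b_def using finite_signed_perms_des_neg by (rule card_inj_on_le)
qed

theorem theorem4p1:
  fixes n k :: nat and U V :: "int set"
  assumes "k \<le> n"
    and "U \<subseteq> {1..int n}" and "V \<subseteq> {1..int n}"
    and "card U = card V"
  shows "b n k U = b n k V"
  using b_le[of U n V k] b_le[of V n U k] assms by simp

end
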